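(* Let $q>2$ be a prime power and let $G$ be a connected unicyclic graph on $s$ vertices $t_1,\dots,t_s$ whose unique induced cycle $C_n$ has odd length $n$. Then for any nonzero $f\in KE(G)$ with exactly $r$ non-zero terms, $$|V_{(\mathbb{F}_q^* )^s}(f)|=\sum_{i=1}^{r-1}(-1)^{i+1}(q-1)^{s-i}.$$ Then the weight distribution of $\mathcal{C}_G$ is as follows: $$A_{\sum_{i=0}^{r-1}(-1)^i(q-1)^{s-i}}(\mathcal{C}_G)=\binom{s}{r}(q-1)^r\quad\text{for every } r\in\{1,2,\dots,s\},$$ and $A_j(\mathcal{C}_G)=0$ for the remaining values of $j\ge 1$. Consequently, the minimum distance of $\mathcal{C}_G$ corresponds to $r=2$, that is, $$\delta(\mathcal{C}_G)=(q-1)^{s-1}(q-2),$$ and it is achieved with all polynomials $f\in KE(G)$ with exactly two non-zero terms.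
   Context: $K=\mathbb{F}_q$ is the finite field with $q$ elements and $\mathbb{F}_q^*=\mathbb{F}_q\setminus\{0\}$. Graphs are finite and simple. A cycle in a graph is induced if no edge joins two non-consecutive vertices of the cycle; a graph is unicyclic if it contains exactly one induced cycle. For a graph $G$ on vertex set $\{t_1,\dots,t_s\}$ with edge set $E$, the vertices are also regarded as variables and $KE(G)=\mathrm{span}_K\{t_it_j : \{t_i,t_j\}\in E\}\subseteq K[t_1,\dots,t_s]$. The number of non-zero terms of $f\in KE(G)$ is the number of edge monomials $t_it_j$ having non-zero coefficient in $f$. Put $T=(\mathbb{F}_q^* )^s=\{P_1,\dots,P_{|T|}\}$, $|T|=(q-1)^s$. For a polynomial $f$, $V_T(f)=\{P\in T: f(P)=0\}$. The edge code of $G$ is $\mathcal{C}_G=\{(f(P_1),\dots,f(P_{|T|})): f\in KE(G)\}\subseteq K^{|T|}$. The Hamming weight of a codeword is its number of non-zero coordinates; $A_i(\mathcal{C}_G)$ is the number of codewords of Hamming weight $i$ ($1\le i\le |T|$), the weight distribution is $(A_1(\mathcal{C}_G),\dots,A_{|T|}(\mathcal{C}_G))$, and the minimum distance $\delta(\mathcal{C}_G)$ is the smallest $i\ge1$ with $A_i(\mathcal{C}_G)\neq 0$. Empty sums are $0$. *)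

theory Defs
  imports Complex_Main "HOL-Library.Cardinality" "HOL-Library.Poly_Mapping" "HOL-Library.FuncSet"
begin

subsection \<open>Graphs\<close>

definition simple_graph :: "'v set \<Rightarrow> 'v set set \<Rightarrow> bool" where
  "simple_graph V E \<longleftrightarrow> finite V \<and> (\<forall>e\<in>E. e \<subseteq> V \<and> card e = 2)"

definition connected_graph :: "'v set \<Rightarrow> 'v set set \<Rightarrow> bool" where
  "connected_graph V E \<longleftrightarrow> V \<noteq> {} \<and> (\<forall>u\<in>V. \<forall>v\<in>V. (u, v) \<in> {(x, y). {x, y} \<in> E}\<^sup>*)"

text \<open>A cycle is a subgraph, identified with its set of edges, so that a cyclic vertex sequence,
  its rotations and its reversals are the same cycle. Its length is its number of edges.\<close>

definition cyclic_edges :: "'v list \<Rightarrow> 'v set set" where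
  "cyclic_edges xs = {{xs ! i, xs ! (Suc i mod length xs)} | i. i < length xs}"

definition cycle_in :: "'v set set \<Rightarrow> 'v set set \<Rightarrow> bool" where
  "cycle_in E C \<longleftrightarrow>
     C \<subseteq> E \<and> (\<exists>xs. distinct xs \<and> 3 \<le> length xs \<and> C = cyclic_edges xs)"

definition induced_cycle :: "'v set set \<Rightarrow> 'v set set \<Rightarrow> bool" where
  "induced_cycle E C \<longleftrightarrow>
     cycle_in E C \<and> (\<forall>u\<in>\<Union>C. \<forall>v\<in>\<Union>C. {u, v} \<in> E \<longrightarrow> {u, v} \<in> C)"

definition unicyclic :: "'v set set \<Rightarrow> bool" where
  "unicyclic E \<longleftrightarrow> (\<exists>!C. induced_cycle E C)"

subsection \<open>Polynomials\<close>

text \<open>Polynomials with variables in \<^typ>\<open>'v\<close> are finitely supported functions from exponent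
  vectors to coefficients.\<close>

type_synonym ('v, 'k) mpoly = "('v \<Rightarrow>\<^sub>0 nat) \<Rightarrow>\<^sub>0 'k"

definition mpoly_scale :: "'k::field \<Rightarrow> ('v, 'k) mpoly \<Rightarrow> ('v, 'k) mpoly" where
  "mpoly_scale c f = Poly_Mapping.map ((*) c) f"

lemma lookup_mpoly_scale:
  "Poly_Mapping.lookup (mpoly_scale c f) m = c * Poly_Mapping.lookup f m"
  by (simp add: mpoly_scale_def Poly_Mapping.map.rep_eq when_def)

interpretation mpoly: vector_space mpoly_scale
  by unfold_locales
    (auto intro!: poly_mapping_eqI simp: lookup_mpoly_scale lookup_add algebra_simps)

definition mpoly_eval :: "('v \<Rightarrow> 'k::field) \<Rightarrow> ('v, 'k) mpoly \<Rightarrow> 'k" where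
  "mpoly_eval P f =
     (\<Sum>m\<in>Poly_Mapping.keys f. Poly_Mapping.lookup f m *
        (\<Prod>v\<in>Poly_Mapping.keys m. P v ^ Poly_Mapping.lookup m v))"

text \<open>The exponent vectors of the monomials \<open>t\<^sub>i t\<^sub>j\<close> with \<open>{t\<^sub>i, t\<^sub>j}\<close> an edge.\<close>

definition edge_monomials :: "'v set set \<Rightarrow> ('v \<Rightarrow>\<^sub>0 nat) set" where
  "edge_monomials E =
     {Poly_Mapping.single i 1 + Poly_Mapping.single j 1 | i j. {i, j} \<in> E}"

definition edge_space :: "'v set set \<Rightarrow> ('v, 'k::field) mpoly set" where
  "edge_space E = mpoly.span ((\<lambda>m. Poly_Mapping.single m 1) ` edge_monomials E)"

definition num_terms :: "'v set set \<Rightarrow> ('v, 'k::field) mpoly \<Rightarrow> nat" where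
  "num_terms E f = card {m \<in> edge_monomials E. Poly_Mapping.lookup f m \<noteq> 0}"

subsection \<open>Evaluation codes on the torus\<close>

definition torus :: "'v set \<Rightarrow> ('v \<Rightarrow> 'k::field) set" where
  "torus V = V \<rightarrow>\<^sub>E (UNIV - {0})"

definition torus_zeros :: "'v set \<Rightarrow> ('v, 'k::field) mpoly \<Rightarrow> ('v \<Rightarrow> 'k) set" where
  "torus_zeros V f = {P \<in> torus V. mpoly_eval P f = 0}"

text \<open>The list \<open>Ps\<close> is the enumeration of the points of the torus; codewords are the lists of
  values at these points.\<close>

definition codeword :: "('v \<Rightarrow> 'k::field) list \<Rightarrow> ('v, 'k) mpoly \<Rightarrow> 'k list" where
  "codeword Ps f = map (\<lambda>P. mpoly_eval P f) Ps"

definition edge_code :: "('v \<Rightarrow> 'k::field) list \<Rightarrow> 'v set set \<Rightarrow> 'k list set" where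
  "edge_code Ps E = codeword Ps ` edge_space E"

definition hamming_weight :: "'k::zero list \<Rightarrow> nat" where
  "hamming_weight c = card {i. i < length c \<and> c ! i \<noteq> 0}"

definition weight_count :: "'k::zero list set \<Rightarrow> nat \<Rightarrow> nat" where
  "weight_count \<C> i = card {c \<in> \<C>. hamming_weight c = i}"

definition min_distance :: "'k::zero list set \<Rightarrow> nat" where
  "min_distance \<C> = (LEAST i. 1 \<le> i \<and> weight_count \<C> i \<noteq> 0)"

text \<open>The alternating sum giving the weights. It has natural number values in the relevant range
  but is formed in the integers, since natural number subtraction truncates.\<close>

definition edge_weight :: "nat \<Rightarrow> nat \<Rightarrow> nat \<Rightarrow> int" where
  "edge_weight q s r = (\<Sum>i\<in>{0..<r}. (-1) ^ i * (int q - 1) ^ (s - i))"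

end

theory Submission imports Defs begin

text \<open>Write \<open>m = q - 1\<close>. The key is to replace the quadratic form \<open>f = \<Sum>\<^sub>e c\<^sub>e t\<^sub>i t\<^sub>j\<close>, with \<open>e = {i, j}\<close> ranging
over the edges, by the linear form \<open>\<Sum>\<^sub>e c\<^sub>e y\<^sub>e\<close> in one variable per edge. The obvious substitution
\<open>y\<^sub>e = t\<^sub>i t\<^sub>j\<close> is a group homomorphism between tori of the same dimension, but for odd \<open>q\<close> it is
not onto: around the odd cycle the product of the \<open>y\<^sub>e\<close> is the square of the product of the \<open>t\<^sub>i\<close>.
Since vanishing of \<open>f\<close> is a homogeneous condition, an additional scalar \<open>l\<close> may be thrown in: the
homomorphism \<open>(t, l) \<mapsto> (l t\<^sub>i t\<^sub>j)\<^sub>e\<close> is onto for every \<open>q\<close>, hence all of its fibres have \<open>m\<close>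
points, and \<open>f\<close> has as many non-zeros on its torus as the linear form has on the torus of
the edges (\<open>card_edge_form_nonzeros\<close>).

Surjectivity, and the fact that the two tori have the same dimension, come from the shape of the
graph. A cycle with a chord splits into two distinct shorter cycles, so by induction on the length
the unique induced cycle is the only cycle (\<open>cycle_eq_unique_induced_cycle\<close>). A connected graph
with a single cycle arises from the cycle by attaching pendant edges one at a time
(\<open>only_cycle_imp_pendant_growth\<close>). On the odd cycle the prescribed edge values are met by a suitable
\<open>l\<close> (\<open>odd_cycle_scaled_solution\<close>), and each pendant edge has a new end vertex whose value can be
solved for.

The non-zeros of a linear form with \<open>r\<close> terms are counted by adding one variable at a time
(\<open>card_linear_form_nonzeros\<close>); this yields the alternating sum \<open>W\<^sub>r\<close>. From the closed form
\<open>q W\<^sub>r = m\<^bsup>s+1\<^esup> - (-1)\<^bsup>r\<^esup> m\<^bsup>s+1-r\<^esup>\<close> and \<open>m \<ge> 2\<close> one reads off that \<open>W\<^sub>1, \<dots>, W\<^sub>s\<close> are positive and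
distinct and that \<open>W\<^sub>2\<close> is the smallest. Positivity makes the evaluation map injective on the edge
space, and distinctness makes the words of weight \<open>W\<^sub>r\<close> exactly the images of the polynomials
with \<open>r\<close> terms, which are counted by choosing a support and non-zero coefficients.\<close>

section \<open>Paths and cycles\<close>

fun path_edges :: "'v list \<Rightarrow> 'v set set" where
  "path_edges (x # y # zs) = insert {x, y} (path_edges (y # zs))"
| "path_edges _ = {}"

lemma path_edges_nth: "path_edges xs = {{xs ! i, xs ! Suc i} | i. Suc i < length xs}"
proof (induction xs rule: path_edges.induct)
  case (1 x y zs)
  have "{{(x # y # zs) ! i, (x # y # zs) ! Suc i} | i. Suc i < length (x # y # zs)}
      = insert {x, y} {{(y # zs) ! i, (y # zs) ! Suc i} | i. Suc i < length (y # zs)}"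
    (is "?L = ?R")
  proof
    show "?L \<subseteq> ?R"
    proof
      fix e assume "e \<in> ?L"
      then obtain i where i: "e = {(x # y # zs) ! i, (x # y # zs) ! Suc i}"
        "Suc i < length (x # y # zs)" by blast
      show "e \<in> ?R" using i by (cases i) auto
    qed
    show "?R \<subseteq> ?L"
    proof
      fix e assume "e \<in> ?R"
      then consider "e = {x, y}"
        | i where "e = {(y # zs) ! i, (y # zs) ! Suc i}" "Suc i < length (y # zs)" by blast
      then show "e \<in> ?L"
      proof cases
        case 1
        then show ?thesis by (intro CollectI exI[of _ 0]) auto
      next
        case (2 i)
        then show ?thesis by (intro CollectI exI[of _ "Suc i"]) auto
      qed
    qed
  qed
  then show ?case using 1 by simp
qed auto

lemma cyclic_edges_path_edges:
  assumes "xs \<noteq> []"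
  shows "cyclic_edges xs = insert {last xs, hd xs} (path_edges xs)"
proof -
  have split: "{..<length xs} = insert (length xs - 1) {i. Suc i < length xs}"
    using assms by (cases xs) auto
  have "cyclic_edges xs = (\<lambda>i. {xs ! i, xs ! (Suc i mod length xs)}) ` {..<length xs}"
    unfolding cyclic_edges_def by auto
  also have "\<dots> = insert {last xs, hd xs}
      ((\<lambda>i. {xs ! i, xs ! (Suc i mod length xs)}) ` {i. Suc i < length xs})"
    unfolding split using assms by (simp add: last_conv_nth hd_conv_nth)
  also have "(\<lambda>i. {xs ! i, xs ! (Suc i mod length xs)}) ` {i. Suc i < length xs} = path_edges xs"
    unfolding path_edges_nth by auto
  finally show ?thesis .
qed

lemma path_edges_append:
  "xs \<noteq> [] \<Longrightarrow> ys \<noteq> [] \<Longrightarrow>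
    path_edges (xs @ ys) = insert {last xs, hd ys} (path_edges xs \<union> path_edges ys)"
proof (induction xs rule: path_edges.induct)
  case ("2_2" v)
  then show ?case by (cases ys) auto
qed auto

lemma cyclic_edges_rotate: "cyclic_edges (xs @ ys) = cyclic_edges (ys @ xs)"
  by (cases "xs = []"; cases "ys = []")
    (auto simp: cyclic_edges_path_edges path_edges_append)

lemma path_edges_subset: "e \<in> path_edges xs \<Longrightarrow> e \<subseteq> set xs"
  by (induction xs rule: path_edges.induct) auto

lemma Union_path_edges: "2 \<le> length xs \<Longrightarrow> \<Union> (path_edges xs) = set xs"
proof (induction xs rule: path_edges.induct)
  case (1 x y zs)
  then show ?case by (cases zs) auto
qed auto

lemma Union_cyclic_edges: "2 \<le> length xs \<Longrightarrow> \<Union> (cyclic_edges xs) = set xs"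
  using Union_path_edges[of xs] hd_in_set[of xs] last_in_set[of xs]
  by (cases "xs = []") (auto simp: cyclic_edges_path_edges)

lemma finite_path_edges: "finite (path_edges xs)"
  by (induction xs rule: path_edges.induct) auto

lemma card_path_edges: "distinct xs \<Longrightarrow> card (path_edges xs) = length xs - 1"
proof (induction xs rule: path_edges.induct)
  case (1 x y zs)
  have "{x, y} \<notin> path_edges (y # zs)"
    using path_edges_subset[of "{x, y}" "y # zs"] 1 by auto
  then show ?case using 1 by (simp add: finite_path_edges)
qed auto

text \<open>Two vertices on a path of three or more vertices cannot be both its ends and neighbours on it, so
closing the path adds a new edge and a cycle has as many edges as vertices.\<close>

lemma closing_edge_notin_path_edges:
  assumes "distinct xs" "3 \<le> length xs"
  shows "{last xs, hd xs} \<notin> path_edges xs"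
proof -
  obtain x y z zs where xs: "xs = x # y # z # zs"
    using assms(2) by (auto simp: numeral_eq_Suc Suc_le_length_iff)
  have "last (z # zs) \<in> set (z # zs)" by (rule last_in_set) simp
  moreover have "{last xs, x} \<notin> path_edges (y # z # zs)"
    using path_edges_subset[of "{last xs, x}" "y # z # zs"] assms xs by auto
  ultimately show ?thesis using assms xs by (auto simp: doubleton_eq_iff)
qed

lemma card_cyclic_edges:
  "distinct xs \<Longrightarrow> 3 \<le> length xs \<Longrightarrow> card (cyclic_edges xs) = length xs"
  by (subst cyclic_edges_path_edges)
    (auto simp: closing_edge_notin_path_edges card_path_edges finite_path_edges)

lemma sym_adjacency: "sym {(x, y). {x, y} \<in> T}"
  by (auto simp: sym_def insert_commute)

lemma hd_path_reaches:
  "x \<in> set xs \<Longrightarrow> (hd xs, x) \<in> {(x, y). {x, y} \<in> path_edges xs}\<^sup>*"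
proof (induction xs rule: path_edges.induct)
  case (1 a b zs)
  show ?case
  proof (cases "x = a")
    case False
    then have "(b, x) \<in> {(x, y). {x, y} \<in> path_edges (b # zs)}\<^sup>*" using 1 by auto
    then have "(b, x) \<in> {(x, y). {x, y} \<in> path_edges (a # b # zs)}\<^sup>*"
      by (rule rtrancl_mono[THEN subsetD, rotated]) auto
    then show ?thesis by (auto intro: converse_rtrancl_into_rtrancl)
  qed auto
qed auto

lemma connected_cyclic_edges:
  assumes "3 \<le> length xs"
  shows "connected_graph (\<Union> (cyclic_edges xs)) (cyclic_edges xs)"
proof -
  let ?R = "{(x, y). {x, y} \<in> cyclic_edges xs}"
  have ne: "xs \<noteq> []" using assms by auto
  have reach: "(hd xs, x) \<in> ?R\<^sup>*" if "x \<in> set xs" for x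
    using hd_path_reaches[OF that]
    by (rule rtrancl_mono[THEN subsetD, rotated]) (auto simp: cyclic_edges_path_edges[OF ne])
  have "(u, v) \<in> ?R\<^sup>*" if "u \<in> set xs" "v \<in> set xs" for u v
    using reach[OF that(1)] reach[OF that(2)]
      sym_rtrancl[OF sym_adjacency[of "cyclic_edges xs"]]
    by (meson rtrancl_trans symD)
  moreover have "\<Union> (cyclic_edges xs) = set xs"
    using assms by (intro Union_cyclic_edges) auto
  ultimately show ?thesis using ne by (auto simp: connected_graph_def)
qed

text \<open>A walk becomes a path by cutting out the detour between two visits to the same vertex.\<close>

lemma simple_path_between:
  assumes "(u, v) \<in> {(x, y). {x, y} \<in> T}\<^sup>*"
  obtains xs where "xs \<noteq> []" "distinct xs" "hd xs = u" "last xs = v" "path_edges xs \<subseteq> T"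
proof -
  have "\<exists>xs. xs \<noteq> [] \<and> distinct xs \<and> hd xs = u \<and> last xs = v \<and> path_edges xs \<subseteq> T"
    using assms
  proof (induction rule: converse_rtrancl_induct)
    case base
    show ?case by (rule exI[of _ "[v]"]) auto
  next
    case (step u w)
    then obtain xs where xs: "xs \<noteq> []" "distinct xs" "hd xs = w" "last xs = v" "path_edges xs \<subseteq> T"
      by blast
    show ?case
    proof (cases "u \<in> set xs")
      case True
      then obtain as bs where "xs = as @ u # bs" by (meson split_list)
      then show ?thesis using xs
        by (intro exI[of _ "u # bs"]) (cases "as = []"; auto simp: path_edges_append)
    next
      case False
      then show ?thesis using xs step by (intro exI[of _ "u # xs"]) (cases xs; auto)
    qed
  qed
  then show ?thesis using that by blast
qed

section \<open>Graphs with a single induced cycle\<close>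

text \<open>After a rotation the cycle reads \<open>u, cs, v, ds\<close>. Since \<open>{u, v}\<close> is a chord, neither arc \<open>cs\<close> nor
\<open>ds\<close> is empty, and closing each arc with the chord gives a cycle that misses the vertices of the
other arc.\<close>

lemma chord_splits_cycle:
  assumes "distinct xs" and sub: "cyclic_edges xs \<subseteq> E"
    and "u \<in> set xs" "v \<in> set xs" "u \<noteq> v" and uv: "{u, v} \<in> E" "{u, v} \<notin> cyclic_edges xs"
  obtains ys zs where "distinct ys" "distinct zs" "3 \<le> length ys" "3 \<le> length zs"
    "length ys < length xs" "length zs < length xs"
    "cyclic_edges ys \<subseteq> E" "cyclic_edges zs \<subseteq> E" "cyclic_edges ys \<noteq> cyclic_edges zs"
proof -
  obtain as bs where xs: "xs = as @ u # bs" using assms by (meson split_list)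
  have "v \<in> set (bs @ as)" using assms xs by auto
  then obtain cs ds where cd: "bs @ as = cs @ v # ds" by (meson split_list)
  have cyc: "cyclic_edges xs = cyclic_edges (u # cs @ v # ds)"
    using cyclic_edges_rotate[of as "u # bs"] xs cd by simp
  have dist: "distinct (u # cs @ v # ds)" and len: "length xs = length (u # cs @ v # ds)"
    unfolding cd[symmetric] using assms(1) by (auto simp: xs)
  \<comment> \<open>With an empty arc, \<open>{u, v}\<close> would be an edge of the cycle itself.\<close>
  have cs: "cs \<noteq> []"
    using uv(2) unfolding cyc by (auto simp: cyclic_edges_path_edges)
  have ds: "ds \<noteq> []"
    using uv(2) unfolding cyc by (auto simp: cyclic_edges_path_edges insert_commute)
  have P: "path_edges (u # cs) = insert {u, hd cs} (path_edges cs)"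
    "path_edges (v # ds) = insert {v, hd ds} (path_edges ds)"
    using path_edges_append[of "[u]" cs] path_edges_append[of "[v]" ds] cs ds by simp_all
  have eq: "cyclic_edges xs = insert {last ds, u} (insert {last cs, v}
      (insert {u, hd cs} (path_edges cs) \<union> insert {v, hd ds} (path_edges ds)))"
    unfolding cyc
    using path_edges_append[of "u # cs" "v # ds"] cs ds by (simp add: cyclic_edges_path_edges P)
  have 1: "cyclic_edges (u # cs @ [v])
      = insert {v, u} (insert {last cs, v} (insert {u, hd cs} (path_edges cs)))"
    using path_edges_append[of "u # cs" "[v]"] cs by (simp add: cyclic_edges_path_edges P)
  have 2: "cyclic_edges (v # ds @ [u])
      = insert {u, v} (insert {last ds, u} (insert {v, hd ds} (path_edges ds)))"
    using path_edges_append[of "v # ds" "[u]"] ds by (simp add: cyclic_edges_path_edges P)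
  have 3: "3 \<le> length (u # cs @ [v])" "3 \<le> length (v # ds @ [u])"
    using cs ds by (cases cs; cases ds; auto)+
  have "\<Union> (cyclic_edges (u # cs @ [v])) \<noteq> \<Union> (cyclic_edges (v # ds @ [u]))"
  proof -
    have "hd cs \<in> set cs" using cs by simp
    then have "hd cs \<in> set (u # cs @ [v])" "hd cs \<notin> set (v # ds @ [u])" using dist by auto
    moreover have "\<Union> (cyclic_edges (u # cs @ [v])) = set (u # cs @ [v])"
      "\<Union> (cyclic_edges (v # ds @ [u])) = set (v # ds @ [u])"
      by (rule Union_cyclic_edges, simp)+
    ultimately show ?thesis by blast
  qed
  then have "cyclic_edges (u # cs @ [v]) \<noteq> cyclic_edges (v # ds @ [u])" by metis
  moreover have "cyclic_edges (u # cs @ [v]) \<subseteq> E" "cyclic_edges (v # ds @ [u]) \<subseteq> E"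
    using sub uv(1) unfolding eq 1 2 by (simp_all add: insert_commute)
  ultimately show ?thesis
    using dist len cs ds 3 by (intro that[of "u # cs @ [v]" "v # ds @ [u]"]) auto
qed

text \<open>Induction on the length: a cycle that is not induced has a chord, and the two shorter cycles that
the chord cuts off would both equal \<open>C\<close>, although they differ.\<close>

lemma cycle_eq_unique_induced_cycle:
  assumes E: "\<And>e. e \<in> E \<Longrightarrow> card e = 2"
    and uniq: "\<And>D. induced_cycle E D \<Longrightarrow> D = C"
    and "cycle_in E D"
  shows "D = C"
proof -
  have "cyclic_edges xs = C" if "distinct xs" "3 \<le> length xs" "cyclic_edges xs \<subseteq> E" for xs
    using that
  proof (induction xs rule: length_induct)
    case (1 xs)
    have cyc: "cycle_in E (cyclic_edges xs)" using 1 by (auto simp: cycle_in_def)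
    show ?case
    proof (rule ccontr)
      assume "cyclic_edges xs \<noteq> C"
      then have "\<not> induced_cycle E (cyclic_edges xs)" using uniq by blast
      moreover have "\<Union> (cyclic_edges xs) = set xs"
        using 1 by (intro Union_cyclic_edges) auto
      ultimately obtain u v where uv: "u \<in> set xs" "v \<in> set xs" "{u, v} \<in> E" "{u, v} \<notin> cyclic_edges xs"
        using cyc by (auto simp: induced_cycle_def)
      moreover have "u \<noteq> v" using E[OF uv(3)] by auto
      ultimately obtain ys zs where "distinct ys" "distinct zs" "3 \<le> length ys" "3 \<le> length zs"
        "length ys < length xs" "length zs < length xs"
        "cyclic_edges ys \<subseteq> E" "cyclic_edges zs \<subseteq> E" "cyclic_edges ys \<noteq> cyclic_edges zs"
        using chord_splits_cycle[of xs E u v] 1 by metis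
      then show False using 1 by metis
    qed
  qed
  then show ?thesis using assms(3) by (auto simp: cycle_in_def)
qed

text \<open>The subgraphs \<open>(S, T)\<close> obtained from \<open>C\<close> by repeatedly joining a new vertex \<open>w\<close> to an old one.
This description serves as an induction principle for connected graphs with a single cycle: every
step adds one vertex and one edge, and the new vertex lies on no earlier edge.\<close>

inductive pendant_growth :: "'v set set \<Rightarrow> 'v set \<Rightarrow> 'v set set \<Rightarrow> bool" for C where
  base: "pendant_growth C (\<Union> C) C"
| step: "pendant_growth C S T \<Longrightarrow> v \<in> S \<Longrightarrow> w \<notin> S \<Longrightarrow>
    pendant_growth C (insert w S) (insert {v, w} T)"

lemma pendant_growth_Union: "pendant_growth C S T \<Longrightarrow> \<Union> T \<subseteq> S"
  by (induction rule: pendant_growth.induct) auto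

lemma pendant_growth_contains: "pendant_growth C S T \<Longrightarrow> C \<subseteq> T"
  by (induction rule: pendant_growth.induct) auto

lemma pendant_growth_card:
  assumes "pendant_growth C S T" "finite C" "finite (\<Union> C)" "card C = card (\<Union> C)"
  shows "finite S \<and> finite T \<and> card T = card S"
  using assms(1)
proof (induction rule: pendant_growth.induct)
  case (step S T v w)
  then have "{v, w} \<notin> T" using pendant_growth_Union[OF step(1)] by auto
  then show ?case using step by auto
qed (use assms in auto)

lemma pendant_growth_connected:
  assumes "pendant_growth C S T" "connected_graph (\<Union> C) C"
  shows "connected_graph S T"
  using assms(1)
proof (induction rule: pendant_growth.induct)
  case (step S T v w)
  let ?R = "{(x, y). {x, y} \<in> insert {v, w} T}"
  have old: "(x, y) \<in> ?R\<^sup>*" if "x \<in> S" "y \<in> S" for x y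
  proof -
    have "(x, y) \<in> {(x, y). {x, y} \<in> T}\<^sup>*"
      using step.IH that by (auto simp: connected_graph_def)
    then show ?thesis by (rule rtrancl_mono[THEN subsetD, rotated]) auto
  qed
  have new: "(x, w) \<in> ?R\<^sup>*" if "x \<in> S" for x
    using old[OF that step(2)] by (auto intro: rtrancl_into_rtrancl)
  have "(w, x) \<in> ?R\<^sup>*" if "x \<in> S" for x
    using new[OF that] sym_rtrancl[OF sym_adjacency[of "insert {v, w} T"]] by (meson symD)
  then show ?case using old new by (auto simp: connected_graph_def)
qed (use assms in auto)

text \<open>A largest subgraph grown from \<open>C\<close> covers \<open>V\<close>, since otherwise connectedness supplies an edge that
leaves it. It also contains every edge: an edge outside would be closed to a cycle by a path inside,
and this cycle differs from \<open>C\<close>, all of whose edges belong to the subgraph.\<close>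

lemma only_cycle_imp_pendant_growth:
  assumes G: "simple_graph V E" and conn: "connected_graph V E"
    and C: "cycle_in E C" and only: "\<And>D. cycle_in E D \<Longrightarrow> D = C"
  shows "pendant_growth C V E"
proof -
  have finV: "finite V" and E: "\<And>e. e \<in> E \<Longrightarrow> e \<subseteq> V \<and> card e = 2"
    using G by (auto simp: simple_graph_def)
  obtain cs where cs: "distinct cs" "3 \<le> length cs" "C = cyclic_edges cs" and CE: "C \<subseteq> E"
    using C by (auto simp: cycle_in_def)
  have CV: "\<Union> C \<subseteq> V" using CE E by auto
  have connC: "connected_graph (\<Union> C) C"
    using connected_cyclic_edges cs by metis
  define good where "good S \<longleftrightarrow> S \<subseteq> V \<and> (\<exists>T \<subseteq> E. pendant_growth C S T)" for S
  have "good (\<Union> C)" using CV CE pendant_growth.base[of C] unfolding good_def by blast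
  then obtain S where S: "good S" and max: "\<And>S'. good S' \<Longrightarrow> card S' \<le> card S"
    using ex_has_greatest_nat[of good "\<Union> C" card "Suc (card V)"] finV
    by (metis card_mono good_def less_Suc_eq_le)
  then obtain T where T: "T \<subseteq> E" "pendant_growth C S T" and SV: "S \<subseteq> V"
    by (auto simp: good_def)
  have connT: "connected_graph S T" using pendant_growth_connected[OF T(2) connC] .
  have "S = V"
  proof (rule ccontr)
    assume "S \<noteq> V"
    then obtain z where z: "z \<in> V" "z \<notin> S" using SV by auto
    obtain a where a: "a \<in> S" using connT by (auto simp: connected_graph_def)
    have "(a, z) \<in> {(x, y). {x, y} \<in> E}\<^sup>*"
      using conn a z SV by (auto simp: connected_graph_def)
    then have "z \<notin> S \<Longrightarrow> \<exists>v w. v \<in> S \<and> w \<notin> S \<and> {v, w} \<in> E"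
      by (induction rule: rtrancl_induct) (use a in auto)
    then obtain v w where vw: "v \<in> S" "w \<notin> S" "{v, w} \<in> E" using z by blast
    have "pendant_growth C (insert w S) (insert {v, w} T)"
      using pendant_growth.step[OF T(2)] vw by blast
    then have "good (insert w S)" using T vw SV E unfolding good_def by blast
    moreover have "finite S" using SV finV finite_subset by blast
    ultimately show False using max[of "insert w S"] vw by simp
  qed
  moreover have "T = E"
  proof (rule ccontr)
    assume "T \<noteq> E"
    then obtain e where e: "e \<in> E" "e \<notin> T" using T by auto
    then obtain u v where uv: "e = {u, v}" "u \<noteq> v" using E by (meson card_2_iff)
    then have "u \<in> S" "v \<in> S" using E e \<open>S = V\<close> by auto
    then have "(u, v) \<in> {(x, y). {x, y} \<in> T}\<^sup>*" using connT by (auto simp: connected_graph_def)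
    then obtain xs where xs: "xs \<noteq> []" "distinct xs" "hd xs = u" "last xs = v" "path_edges xs \<subseteq> T"
      by (rule simple_path_between)
    have "3 \<le> length xs"
    proof (rule ccontr)
      assume "\<not> ?thesis"
      then consider "length xs = 0" | "length xs = 1" | "length xs = 2" by linarith
      then show False
        using xs uv e by cases (auto simp: length_Suc_conv numeral_2_eq_2)
    qed
    moreover have cyc: "cyclic_edges xs = insert e (path_edges xs)"
      using xs uv by (simp add: cyclic_edges_path_edges insert_commute)
    ultimately have "cycle_in E (cyclic_edges xs)"
      using xs T e by (auto simp: cycle_in_def)
    then have "e \<in> C" using only cyc by blast
    then show False using pendant_growth_contains[OF T(2)] e by auto
  qed
  ultimately show ?thesis using T by simp
qed

section \<open>Prescribing the values of the edge monomials\<close>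

text \<open>Solving \<open>l P\<^sub>i P\<^sub>j = y\<^sub>e\<close> along a path from a given starting value, two edges at a time. The vertex
\<open>b\<close> two steps after \<open>x\<close> gets the value \<open>P b = y {a, b} / y {x, a} * P x\<close>, in which \<open>l\<close> cancels.
So the value \<open>d\<close> at the end of a path with an even number of edges does not depend on \<open>l\<close>, which
is why \<open>d\<close> is quantified before \<open>l\<close>.\<close>

lemma even_path_solution:
  fixes y :: "'v set \<Rightarrow> 'k::field"
  assumes "even (length zs)" "distinct (x # zs)" "c \<noteq> 0" "\<forall>e\<in>path_edges (x # zs). y e \<noteq> 0"
  shows "\<exists>d. d \<noteq> 0 \<and> (\<forall>l. l \<noteq> 0 \<longrightarrow> (\<exists>P. (\<forall>v. P v \<noteq> 0) \<and> P x = c \<and> P (last (x # zs)) = d \<and>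
           (\<forall>e\<in>path_edges (x # zs). l * (\<Prod>v\<in>e. P v) = y e)))"
  using assms
proof (induction zs arbitrary: x c rule: induct_list012)
  case 1
  then show ?case by (intro exI[of _ c]) auto
next
  case (3 a b zs)
  define c' where "c' = y {a, b} * c / y {x, a}"
  have y: "y {a, b} \<noteq> 0" "y {x, a} \<noteq> 0" using 3 by auto
  then have c': "c' \<noteq> 0" using 3 by (simp add: c'_def)
  have "\<exists>d. d \<noteq> 0 \<and> (\<forall>l. l \<noteq> 0 \<longrightarrow> (\<exists>P. (\<forall>v. P v \<noteq> 0) \<and> P b = c' \<and> P (last (b # zs)) = d \<and>
           (\<forall>e\<in>path_edges (b # zs). l * (\<Prod>v\<in>e. P v) = y e)))"
    using 3 c' by (intro "3.IH"(1)) auto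
  then obtain d where d: "d \<noteq> 0" and sol: "\<And>l. l \<noteq> 0 \<Longrightarrow> \<exists>P. (\<forall>v. P v \<noteq> 0) \<and> P b = c' \<and>
      P (last (b # zs)) = d \<and> (\<forall>e\<in>path_edges (b # zs). l * (\<Prod>v\<in>e. P v) = y e)"
    by blast
  have "\<exists>P. (\<forall>v. P v \<noteq> 0) \<and> P x = c \<and> P (last (x # a # b # zs)) = d \<and>
           (\<forall>e\<in>path_edges (x # a # b # zs). l * (\<Prod>v\<in>e. P v) = y e)" if l: "l \<noteq> 0" for l
  proof -
    obtain P where P: "\<forall>v. P v \<noteq> 0" "P b = c'" "P (last (b # zs)) = d"
      "\<forall>e\<in>path_edges (b # zs). l * (\<Prod>v\<in>e. P v) = y e"
      using sol[OF l] by blast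
    define Q where "Q = P(x := c, a := y {x, a} / (l * c))"
    have dist: "x \<notin> set (b # zs)" "a \<notin> set (b # zs)" "x \<noteq> a" "x \<noteq> b" "a \<noteq> b" using 3 by auto
    have Q: "Q v = P v" if "v \<in> set (b # zs)" for v
      using that dist by (auto simp: Q_def)
    have "l * (\<Prod>v\<in>e. Q v) = y e" if "e \<in> path_edges (b # zs)" for e
    proof -
      have "(\<Prod>v\<in>e. Q v) = (\<Prod>v\<in>e. P v)"
        using path_edges_subset[OF that] Q by (intro prod.cong) auto
      then show ?thesis using P that by simp
    qed
    moreover have "l * (\<Prod>v\<in>{x, a}. Q v) = y {x, a}"
      using dist l 3 by (simp add: Q_def)
    moreover have "l * (\<Prod>v\<in>{a, b}. Q v) = y {a, b}"
      using dist l 3 P y by (simp add: Q_def c'_def)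
    moreover have "Q (last (b # zs)) = d" using Q[of "last (b # zs)"] P by auto
    moreover have "\<forall>v. Q v \<noteq> 0" using P l 3 y by (auto simp: Q_def)
    moreover have "Q x = c" using dist by (simp add: Q_def)
    ultimately show ?thesis by (intro exI[of _ Q]) auto
  qed
  then show ?case using d by blast
qed auto

text \<open>Removing the closing edge from an odd cycle leaves a path with an even number of edges. The values at
the two ends of this path are the same for all \<open>l\<close>, so the equation of the closing edge determines
\<open>l\<close> instead of imposing a condition on \<open>y\<close>.\<close>

lemma odd_cycle_scaled_solution:
  fixes y :: "'v set \<Rightarrow> 'k::field"
  assumes "distinct xs" "3 \<le> length xs" "odd (length xs)" "\<forall>e\<in>cyclic_edges xs. y e \<noteq> 0"
  shows "\<exists>l P. l \<noteq> 0 \<and> (\<forall>v. P v \<noteq> 0) \<and> (\<forall>e\<in>cyclic_edges xs. l * (\<Prod>v\<in>e. P v) = y e)"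
proof -
  obtain x zs where xs: "xs = x # zs" using assms by (cases xs) auto
  have cyc: "cyclic_edges xs = insert {last xs, x} (path_edges xs)"
    using xs by (simp add: cyclic_edges_path_edges)
  have ne: "last xs \<noteq> x" using xs assms by (cases zs rule: rev_cases) auto
  obtain d where d: "d \<noteq> 0" and sol: "\<And>l. l \<noteq> 0 \<Longrightarrow> \<exists>P. (\<forall>v. P v \<noteq> 0) \<and> P x = 1 \<and>
      P (last xs) = d \<and> (\<forall>e\<in>path_edges xs. l * (\<Prod>v\<in>e. P v) = y e)"
    using even_path_solution[of zs x 1 y] assms cyc unfolding xs by auto
  define l where "l = y {last xs, x} / d"
  have l: "l \<noteq> 0" using assms cyc d by (simp add: l_def)
  then obtain P where P: "\<forall>v. P v \<noteq> 0" "P x = 1" "P (last xs) = d"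
    "\<forall>e\<in>path_edges xs. l * (\<Prod>v\<in>e. P v) = y e" using sol by blast
  have "l * (\<Prod>v\<in>{last xs, x}. P v) = y {last xs, x}"
    using ne P d by (simp add: l_def)
  then show ?thesis using P l unfolding cyc by blast
qed

text \<open>A pendant edge imposes a single equation on the value at its new vertex, and this value occurs in
no earlier equation.\<close>

lemma pendant_growth_scaled_solution:
  fixes y :: "'v set \<Rightarrow> 'k::field"
  assumes "pendant_growth C S T" "l \<noteq> 0" "\<forall>e\<in>T. y e \<noteq> 0"
    and "\<forall>v. P v \<noteq> 0" "\<forall>e\<in>C. l * (\<Prod>v\<in>e. P v) = y e"
  shows "\<exists>P. (\<forall>v. P v \<noteq> 0) \<and> (\<forall>e\<in>T. l * (\<Prod>v\<in>e. P v) = y e)"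
  using assms(1,3)
proof (induction rule: pendant_growth.induct)
  case (step S T v w)
  then obtain P where P: "\<forall>v. P v \<noteq> 0" "\<forall>e\<in>T. l * (\<Prod>v\<in>e. P v) = y e" by auto
  define Q where "Q = P(w := y {v, w} / (l * P v))"
  have "l * (\<Prod>v\<in>e. Q v) = y e" if "e \<in> T" for e
  proof -
    have "(\<Prod>v\<in>e. Q v) = (\<Prod>v\<in>e. P v)"
      using pendant_growth_Union[OF step(1)] step that by (intro prod.cong) (auto simp: Q_def)
    then show ?thesis using P that by simp
  qed
  moreover have "l * (\<Prod>v\<in>{v, w}. Q v) = y {v, w}"
    using step P assms by (cases "v = w") (auto simp: Q_def)
  moreover have "\<forall>v. Q v \<noteq> 0" using P assms step by (auto simp: Q_def)
  ultimately show ?case by (intro exI[of _ Q]) auto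
qed (use assms in auto)

section \<open>Reduction to a linear form on a torus\<close>

lemma finite_torus: "finite V \<Longrightarrow> finite (torus V :: ('v \<Rightarrow> 'k::{field, finite}) set)"
  by (auto simp: torus_def intro: finite_PiE)

lemma card_torus:
  "finite V \<Longrightarrow> card (torus V :: ('v \<Rightarrow> 'k::{field, finite}) set) = (CARD('k) - 1) ^ card V"
  by (simp add: torus_def card_PiE card_Diff_singleton)

lemma card_preimage_equal_fibres:
  assumes "finite A" "finite Z" "\<And>z. z \<in> Z \<Longrightarrow> card {x \<in> A. \<phi> x = z} = k"
  shows "card {x \<in> A. \<phi> x \<in> Z} = k * card Z"
proof -
  have "{x \<in> A. \<phi> x \<in> Z} = (\<Union>z\<in>Z. {x \<in> A. \<phi> x = z})" by auto
  also have "card \<dots> = (\<Sum>z\<in>Z. card {x \<in> A. \<phi> x = z})"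
    using assms by (intro card_UN_disjoint) auto
  also have "\<dots> = k * card Z" using assms by simp
  finally show ?thesis .
qed

text \<open>The map \<open>\<phi> (P, l) = (l * \<Prod>v\<in>e. P v)\<^sub>e\<close> is a homomorphism onto the torus of the edges, so each of its
fibres is a translate of the fibre over \<open>1\<close>. Comparing the sizes of the source and the target,
where \<open>card E = card V\<close> enters, shows that a fibre has \<open>CARD('k) - 1\<close> points. The pullback of the
linear form along \<open>\<phi>\<close> is \<open>l\<close> times the edge form, so its non-zeros are the non-zeros \<open>P\<close> of the
edge form, each counted once for every \<open>l \<noteq> 0\<close>.\<close>

lemma card_edge_form_nonzeros:
  fixes c :: "'v set \<Rightarrow> 'k::{field, finite}"
  assumes fin: "finite V" "finite E" and EV: "\<And>e. e \<in> E \<Longrightarrow> e \<subseteq> V"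
    and card: "card E = card V"
    and solvable: "\<And>y :: 'v set \<Rightarrow> 'k. \<forall>e\<in>E. y e \<noteq> 0 \<Longrightarrow>
      \<exists>l P. l \<noteq> 0 \<and> (\<forall>v. P v \<noteq> 0) \<and> (\<forall>e\<in>E. l * (\<Prod>v\<in>e. P v) = y e)"
  shows "card {P \<in> torus V. (\<Sum>e\<in>E. c e * (\<Prod>v\<in>e. P v)) \<noteq> 0}
       = card {y \<in> torus E. (\<Sum>e\<in>E. c e * y e) \<noteq> 0}"
proof -
  let ?U = "UNIV - {0 :: 'k}"
  define A where "A = (torus V :: ('v \<Rightarrow> 'k) set) \<times> ?U"
  define \<phi> where "\<phi> = (\<lambda>(P, l). restrict (\<lambda>e. l * (\<Prod>v\<in>e. P v)) E :: 'v set \<Rightarrow> 'k)"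
  define k where "k = card {x \<in> A. \<phi> x = (\<lambda>e\<in>E. 1)}"
  have finA: "finite A" using fin by (auto simp: A_def finite_torus)
  have finite_edge: "finite e" if "e \<in> E" for e using EV[OF that] fin finite_subset by blast
  have fibre: "card {x \<in> A. \<phi> x = y} = k" if y: "y \<in> torus E" for y
  proof -
    have "\<forall>e\<in>E. y e \<noteq> 0" using y by (auto simp: torus_def PiE_iff)
    then obtain l P where lP: "l \<noteq> 0" "\<And>v. P v \<noteq> 0" "\<And>e. e \<in> E \<Longrightarrow> l * (\<Prod>v\<in>e. P v) = y e"
      using solvable by metis
    \<comment> \<open>Translation by a point \<open>(P, l)\<close> of the fibre over \<open>y\<close>, and its inverse.\<close>
    define g where "g = (\<lambda>(Q, m). (\<lambda>v\<in>V. P v * Q v :: 'k, l * m))"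
    define h where "h = (\<lambda>(Q, m). (\<lambda>v\<in>V. Q v / P v :: 'k, m / l))"
    have prod_g: "(\<Prod>v\<in>e. if v \<in> V then P v * Q v else undefined) = (\<Prod>v\<in>e. P v) * (\<Prod>v\<in>e. Q v)"
      if "e \<in> E" for e Q
      unfolding prod.distrib[symmetric] using EV[OF that] by (intro prod.cong) auto
    have prod_h: "(\<Prod>v\<in>e. if v \<in> V then Q v / P v else undefined) = (\<Prod>v\<in>e. Q v) / (\<Prod>v\<in>e. P v)"
      if "e \<in> E" for e Q
      unfolding prod_dividef[symmetric] using EV[OF that] by (intro prod.cong) auto
    have eqI: "\<phi> (Q, m) = z \<longleftrightarrow> (\<forall>e\<in>E. m * (\<Prod>v\<in>e. Q v) = z e)" if "z \<in> torus E" for Q m z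
    proof -
      have "z \<in> extensional E" using that by (auto simp: torus_def PiE_def)
      then show ?thesis
        by (auto simp: \<phi>_def restrict_def extensional_def fun_eq_iff)
    qed
    have one: "(\<lambda>e\<in>E. 1 :: 'k) \<in> torus E" by (auto simp: torus_def)
    have "bij_betw g {x \<in> A. \<phi> x = (\<lambda>e\<in>E. 1)} {x \<in> A. \<phi> x = y}"
    proof (rule bij_betw_byWitness[where f' = h])
      show "\<forall>x\<in>{x \<in> A. \<phi> x = (\<lambda>e\<in>E. 1)}. h (g x) = x"
        using lP by (auto simp: A_def g_def h_def torus_def PiE_iff extensional_def fun_eq_iff)
      show "\<forall>x\<in>{x \<in> A. \<phi> x = y}. g (h x) = x"
        using lP by (auto simp: A_def g_def h_def torus_def PiE_iff extensional_def fun_eq_iff)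
      show "g ` {x \<in> A. \<phi> x = (\<lambda>e\<in>E. 1)} \<subseteq> {x \<in> A. \<phi> x = y}"
      proof (rule image_subsetI)
        fix x assume "x \<in> {x \<in> A. \<phi> x = (\<lambda>e\<in>E. 1)}"
        then obtain Q m where x: "x = (Q, m)" and Qm: "(Q, m) \<in> A" "\<phi> (Q, m) = (\<lambda>e\<in>E. 1)"
          by (cases x) auto
        have "g (Q, m) \<in> A" using Qm lP by (auto simp: A_def g_def torus_def PiE_iff)
        moreover have "\<phi> (g (Q, m)) = y"
        proof -
          have "l * m * ((\<Prod>v\<in>e. P v) * (\<Prod>v\<in>e. Q v)) = y e" if "e \<in> E" for e
          proof -
            have "m * (\<Prod>v\<in>e. Q v) = 1" using Qm(2) that unfolding eqI[OF one] by auto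
            then have "(l * (\<Prod>v\<in>e. P v)) * (m * (\<Prod>v\<in>e. Q v)) = y e" using lP(3)[OF that] by simp
            then show ?thesis by (simp add: algebra_simps)
          qed
          then show ?thesis
            unfolding g_def prod.case eqI[OF y] by (simp add: restrict_def prod_g)
        qed
        ultimately show "g x \<in> {x \<in> A. \<phi> x = y}" by (simp add: x)
      qed
      show "h ` {x \<in> A. \<phi> x = y} \<subseteq> {x \<in> A. \<phi> x = (\<lambda>e\<in>E. 1)}"
      proof (rule image_subsetI)
        fix x assume "x \<in> {x \<in> A. \<phi> x = y}"
        then obtain Q m where x: "x = (Q, m)" and Qm: "(Q, m) \<in> A" "\<phi> (Q, m) = y"
          by (cases x) auto
        have "h (Q, m) \<in> A" using Qm lP by (auto simp: A_def h_def torus_def PiE_iff)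
        moreover have "\<phi> (h (Q, m)) = (\<lambda>e\<in>E. 1)"
        proof -
          have "m / l * ((\<Prod>v\<in>e. Q v) / (\<Prod>v\<in>e. P v)) = 1" if "e \<in> E" for e
          proof -
            have "m * (\<Prod>v\<in>e. Q v) = l * (\<Prod>v\<in>e. P v)"
              using Qm(2) that lP(3) unfolding eqI[OF y] by auto
            moreover have "(\<Prod>v\<in>e. P v) \<noteq> 0" using lP finite_edge[OF that] by simp
            ultimately show ?thesis using lP by (simp add: field_simps)
          qed
          then show ?thesis
            unfolding h_def prod.case eqI[OF one] by (simp add: restrict_def prod_h)
        qed
        ultimately show "h x \<in> {x \<in> A. \<phi> x = (\<lambda>e\<in>E. 1)}" by (simp add: x)
      qed
    qed
    then show ?thesis unfolding k_def using bij_betw_same_card by fastforce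
  qed
  have \<phi>A: "\<phi> x \<in> torus E" if "x \<in> A" for x
    using that EV finite_edge by (auto simp: A_def \<phi>_def torus_def PiE_iff split: prod.splits)
  have q: "0 < CARD('k) - 1" using card_mono[of UNIV "{0, 1 :: 'k}"] by simp
  have cardU: "card ?U = CARD('k) - 1" by (simp add: card_Diff_singleton)
  have "card A = k * card (torus E :: ('v set \<Rightarrow> 'k) set)"
  proof -
    have "A = {x \<in> A. \<phi> x \<in> torus E}" using \<phi>A by auto
    then show ?thesis
      using card_preimage_equal_fibres[of A "torus E" \<phi> k] finA fin fibre by (simp add: finite_torus)
  qed
  moreover have "card A = card (torus V :: ('v \<Rightarrow> 'k) set) * (CARD('k) - 1)"
    by (simp add: A_def card_cartesian_product cardU)
  ultimately have k: "k = CARD('k) - 1"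
    using q fin card by (simp add: card_torus)
  let ?N = "{P \<in> torus V. (\<Sum>e\<in>E. c e * (\<Prod>v\<in>e. P v)) \<noteq> 0}"
  let ?Z = "{y \<in> torus E. (\<Sum>e\<in>E. c e * y e) \<noteq> 0}"
  have hom: "(\<Sum>e\<in>E. c e * \<phi> (P, l) e) = l * (\<Sum>e\<in>E. c e * (\<Prod>v\<in>e. P v))" for P l
    unfolding sum_distrib_left by (intro sum.cong) (auto simp: \<phi>_def)
  have "{x \<in> A. \<phi> x \<in> ?Z} = ?N \<times> ?U"
    using \<phi>A by (auto simp: hom) (auto simp: A_def)
  then have "card ?N * (CARD('k) - 1) = card {x \<in> A. \<phi> x \<in> ?Z}"
    by (simp add: card_cartesian_product cardU)
  also have "\<dots> = (CARD('k) - 1) * card ?Z"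
    using card_preimage_equal_fibres[of A ?Z \<phi> k] finA fin fibre k by (simp add: finite_torus)
  finally show ?thesis using q by simp
qed

section \<open>Zeros of a linear form on a torus\<close>

lemma edge_weight_Suc: "r \<le> s \<Longrightarrow> edge_weight q (Suc s) r = (int q - 1) * edge_weight q s r"
  unfolding edge_weight_def sum_distrib_left
  by (intro sum.cong) (auto simp: Suc_diff_le)

lemma edge_weight_Suc_Suc:
  "edge_weight q (Suc s) (Suc r) = (int q - 1) ^ Suc s - edge_weight q s r"
  unfolding edge_weight_def
  by (subst sum.atLeast0_lessThan_Suc_shift) (simp add: sum_negf)

text \<open>Add one variable \<open>t\<close> at a time. If its coefficient is zero, the count is multiplied by \<open>q - 1\<close>.
Otherwise \<open>t\<close> can be solved for, and the solution is non-zero exactly if the rest \<open>L\<close> of the form is: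
the zeros of the longer form correspond to the non-zeros of \<open>L\<close>. The two cases are the recursions
\<open>edge_weight_Suc\<close> and \<open>edge_weight_Suc_Suc\<close>.\<close>

lemma card_linear_form_nonzeros:
  fixes c :: "'e \<Rightarrow> 'k::{field, finite}"
  assumes "finite E"
  shows "int (card {y \<in> torus E. (\<Sum>e\<in>E. c e * y e) \<noteq> 0})
    = edge_weight CARD('k) (card E) (card {e \<in> E. c e \<noteq> 0})"
  using assms
proof (induction E)
  case empty
  then show ?case by (simp add: edge_weight_def)
next
  case (insert a F)
  let ?U = "UNIV - {0 :: 'k}"
  let ?L = "\<lambda>y. \<Sum>e\<in>F. c e * y e"
  let ?G = "\<lambda>(t, y). y(a := t) :: 'e \<Rightarrow> 'k"
  have q: "int (CARD('k) - 1) = int CARD('k) - 1"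
    by (simp add: of_nat_diff Suc_leI)
  have cardU: "card ?U = CARD('k) - 1" by (simp add: card_Diff_singleton)
  have finF: "finite (torus F :: ('e \<Rightarrow> 'k) set)" using insert by (simp add: finite_torus)
  have inj: "inj_on ?G (?U \<times> torus F)"
    unfolding torus_def using inj_combinator[of a F "\<lambda>_. ?U"] insert by simp
  have tor: "torus (insert a F) = ?G ` (?U \<times> torus F)"
    unfolding torus_def by (subst PiE_insert_eq) (simp)
  have L: "(\<Sum>e\<in>insert a F. c e * (?G x) e) = c a * fst x + ?L (snd x)" for x
  proof -
    have "(\<Sum>e\<in>F. c e * (?G x) e) = ?L (snd x)"
      using insert by (intro sum.cong) (auto split: prod.splits)
    then show ?thesis using insert by (auto split: prod.splits)
  qed
  have "{y \<in> torus (insert a F). (\<Sum>e\<in>insert a F. c e * y e) \<noteq> 0}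
      = ?G ` {x \<in> ?U \<times> torus F. c a * fst x + ?L (snd x) \<noteq> 0}"
    unfolding tor L[symmetric] by (rule Compr_image_eq)
  then have card: "card {y \<in> torus (insert a F). (\<Sum>e\<in>insert a F. c e * y e) \<noteq> 0}
      = card {x \<in> ?U \<times> torus F. c a * fst x + ?L (snd x) \<noteq> 0}"
    using card_image[OF inj_on_subset[OF inj]] by (metis (no_types, lifting) mem_Collect_eq subsetI)
  show ?case
  proof (cases "c a = 0")
    case True
    then have "{x \<in> ?U \<times> torus F. c a * fst x + ?L (snd x) \<noteq> 0} = ?U \<times> {y \<in> torus F. ?L y \<noteq> 0}"
      by auto
    then have "int (card {y \<in> torus (insert a F). (\<Sum>e\<in>insert a F. c e * y e) \<noteq> 0})
      = (int CARD('k) - 1) * edge_weight CARD('k) (card F) (card {e \<in> F. c e \<noteq> 0})"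
      unfolding card by (simp add: card_cartesian_product cardU q insert.IH)
    moreover have "{e \<in> insert a F. c e \<noteq> 0} = {e \<in> F. c e \<noteq> 0}" using True by auto
    moreover have "card {e \<in> F. c e \<noteq> 0} \<le> card F" using insert by (intro card_mono) auto
    ultimately show ?thesis using insert by (simp add: edge_weight_Suc)
  next
    case False
    let ?Z = "{x \<in> ?U \<times> torus F. c a * fst x + ?L (snd x) = 0}"
    have "c a * t + b = 0 \<longleftrightarrow> t = - b / c a" for t b
      using False by (metis add_eq_0_iff2 nonzero_eq_divide_eq mult.commute)
    then have "?Z = (\<lambda>y. (- ?L y / c a, y)) ` {y \<in> torus F. ?L y \<noteq> 0}"
      using False by (auto simp: image_iff)
    then have Z: "card ?Z = card {y \<in> torus F. ?L y \<noteq> 0}"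
      by (simp add: card_image inj_on_def)
    let ?A = "?U \<times> (torus F :: ('e \<Rightarrow> 'k) set)"
    have finA: "finite ?A" using finF by simp
    have "{x \<in> ?A. c a * fst x + ?L (snd x) \<noteq> 0} = ?A - ?Z" by auto
    then have "card {x \<in> ?A. c a * fst x + ?L (snd x) \<noteq> 0} = card ?A - card ?Z"
      using finA by (simp only: card_Diff_subset finite_subset[OF _ finA] Collect_subset simp_thms)
    moreover have "card ?Z \<le> card ?A" using finA by (intro card_mono) auto
    moreover have "int (card ?A) = (int CARD('k) - 1) ^ Suc (card F)"
      unfolding card_cartesian_product cardU card_torus[OF insert(1)] of_nat_mult of_nat_power q
      by simp
    ultimately have "int (card {x \<in> ?A. c a * fst x + ?L (snd x) \<noteq> 0})
        = (int CARD('k) - 1) ^ Suc (card F)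
          - edge_weight CARD('k) (card F) (card {e \<in> F. c e \<noteq> 0})"
      using insert.IH unfolding Z by linarith
    also have "\<dots> = edge_weight CARD('k) (Suc (card F)) (Suc (card {e \<in> F. c e \<noteq> 0}))"
      by (rule edge_weight_Suc_Suc[symmetric])
    finally have "int (card {x \<in> ?U \<times> torus F. c a * fst x + ?L (snd x) \<noteq> 0})
        = edge_weight CARD('k) (Suc (card F)) (Suc (card {e \<in> F. c e \<noteq> 0}))" .
    moreover have "{e \<in> insert a F. c e \<noteq> 0} = insert a {e \<in> F. c e \<noteq> 0}" using False by auto
    ultimately show ?thesis using insert unfolding card by simp
  qed
qed

section \<open>The alternating sums as integers\<close>

lemma edge_weight_split_first:
  assumes "1 \<le> r"
  shows "edge_weight q s r
    = (int q - 1) ^ s - (\<Sum>i\<in>{1..<r}. (-1) ^ (i + 1) * (int q - 1) ^ (s - i))"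
  using assms unfolding edge_weight_def
  by (subst sum.atLeast_Suc_lessThan) (auto simp: sum_negf)

text \<open>The alternating sum is geometric with ratio \<open>-1 / (q - 1)\<close>; multiplying by \<open>q\<close> clears the
denominator.\<close>

lemma edge_weight_closed_form:
  "r \<le> s + 1 \<Longrightarrow> int q * edge_weight q s r = (int q - 1) ^ (s + 1) - (-1) ^ r * (int q - 1) ^ (s + 1 - r)"
proof (induction r)
  case 0
  then show ?case by (simp add: edge_weight_def)
next
  case (Suc r)
  then have r: "Suc s - r = Suc (s - r)" by simp
  have "edge_weight q s (Suc r) = edge_weight q s r + (-1) ^ r * (int q - 1) ^ (s - r)"
    by (simp add: edge_weight_def)
  then have "int q * edge_weight q s (Suc r)
      = int q * edge_weight q s r + int q * ((-1) ^ r * (int q - 1) ^ (s - r))"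
    by (simp add: algebra_simps)
  then show ?case using Suc by (simp add: r algebra_simps)
qed

lemma edge_weight_inj:
  assumes "q > 2" "a \<le> s" "b \<le> s" "edge_weight q s a = edge_weight q s b"
  shows "a = b"
proof -
  have "(-1) ^ a * (int q - 1) ^ (s + 1 - a) = (-1) ^ b * (int q - 1) ^ (s + 1 - b)"
    using edge_weight_closed_form[of a s q] edge_weight_closed_form[of b s q] assms by simp
  then have "\<bar>(-1) ^ a * (int q - 1) ^ (s + 1 - a)\<bar> = \<bar>(-1) ^ b * (int q - 1) ^ (s + 1 - b)\<bar>"
    by (rule arg_cong)
  then have "(int q - 1) ^ (s + 1 - a) = (int q - 1) ^ (s + 1 - b)"
    using assms by (simp add: abs_mult power_abs)
  then have "s + 1 - a = s + 1 - b"
    using assms by (subst (asm) power_inject_exp) auto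
  then show ?thesis using assms by simp
qed

lemma edge_weight_pos:
  assumes "q > 2" "1 \<le> r" "r \<le> s"
  shows "0 < edge_weight q s r"
proof -
  have "(-1) ^ r * (int q - 1) ^ (s + 1 - r) \<le> (int q - 1) ^ (s + 1 - r)"
    using assms by (cases "even r") auto
  also have "\<dots> < (int q - 1) ^ (s + 1)"
    using assms by (intro power_strict_increasing) auto
  finally have "0 < int q * edge_weight q s r"
    using edge_weight_closed_form[of r s q] assms by simp
  then show ?thesis by (simp add: zero_less_mult_iff)
qed

lemma edge_weight_min:
  assumes "q > 2" "1 \<le> r" "r \<le> s" "2 \<le> s"
  shows "edge_weight q s 2 \<le> edge_weight q s r"
proof -
  have "(-1) ^ r * (int q - 1) ^ (s + 1 - r) \<le> (int q - 1) ^ (s + 1 - 2)"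
  proof (cases "r = 1")
    case False
    have "(-1) ^ r * (int q - 1) ^ (s + 1 - r) \<le> (int q - 1) ^ (s + 1 - r)"
      using assms by (cases "even r") auto
    also have "\<dots> \<le> (int q - 1) ^ (s + 1 - 2)"
      using assms False by (intro power_increasing) auto
    finally show ?thesis .
  next
    case True
    then have "(-1) ^ r * (int q - 1) ^ (s + 1 - r) \<le> 0" using assms by simp
    also have "0 \<le> (int q - 1) ^ (s + 1 - 2)" using assms by simp
    finally show ?thesis .
  qed
  then have "int q * edge_weight q s 2 \<le> int q * edge_weight q s r"
    using edge_weight_closed_form[of r s q] edge_weight_closed_form[of 2 s q] assms by simp
  then show ?thesis using assms by simp
qed

lemma edge_weight_2:
  assumes "q > 2" "2 \<le> s"
  shows "edge_weight q s 2 = int ((q - 1) ^ (s - 1) * (q - 2))"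
proof -
  obtain t where t: "s = Suc t" using assms by (cases s) auto
  have "edge_weight q s 2 = (int q - 1) ^ t * (int q - 1) - (int q - 1) ^ t"
    by (simp add: edge_weight_def numeral_2_eq_2 t)
  also have "\<dots> = (int q - 1) ^ t * (int q - 2)" by (simp add: algebra_simps)
  finally show ?thesis using assms by (simp add: t of_nat_diff)
qed

section \<open>Polynomials supported on edge monomials\<close>

definition edge_monomial :: "'v set \<Rightarrow> 'v \<Rightarrow>\<^sub>0 nat" where
  "edge_monomial e = (\<Sum>v\<in>e. Poly_Mapping.single v 1)"

lemma lookup_edge_monomial:
  "finite e \<Longrightarrow> Poly_Mapping.lookup (edge_monomial e) v = (if v \<in> e then 1 else 0)"
  by (simp add: edge_monomial_def lookup_sum lookup_single when_def)

lemma keys_edge_monomial: "finite e \<Longrightarrow> Poly_Mapping.keys (edge_monomial e) = e"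
  by (auto simp: in_keys_iff lookup_edge_monomial split: if_splits)

lemma edge_monomials_image:
  assumes "\<And>e. e \<in> E \<Longrightarrow> card e = 2"
  shows "edge_monomials E = edge_monomial ` E"
proof
  show "edge_monomials E \<subseteq> edge_monomial ` E"
  proof
    fix m assume "m \<in> edge_monomials E"
    then obtain i j where ij: "m = Poly_Mapping.single i 1 + Poly_Mapping.single j 1" "{i, j} \<in> E"
      by (auto simp: edge_monomials_def)
    then have "i \<noteq> j" using assms[of "{i, j}"] by auto
    then have "m = edge_monomial {i, j}" using ij by (simp add: edge_monomial_def)
    then show "m \<in> edge_monomial ` E" using ij by blast
  qed
  show "edge_monomial ` E \<subseteq> edge_monomials E"
  proof clarify
    fix e assume e: "e \<in> E"
    then obtain i j where "e = {i, j}" "i \<noteq> j" using assms by (meson card_2_iff)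
    then show "edge_monomial e \<in> edge_monomials E"
      using e by (auto simp: edge_monomials_def edge_monomial_def)
  qed
qed

text \<open>The edge is recovered as the set of variables of its monomial.\<close>

lemma inj_on_edge_monomial:
  assumes "\<And>e. e \<in> E \<Longrightarrow> finite e"
  shows "inj_on edge_monomial E"
  by (rule inj_on_inverseI[where g = Poly_Mapping.keys]) (use assms keys_edge_monomial in blast)

lemma edge_space_keys:
  "(edge_space E :: ('v, 'k::field) mpoly set) = {f. Poly_Mapping.keys f \<subseteq> edge_monomials E}"
proof
  let ?B = "(\<lambda>m. Poly_Mapping.single m (1::'k)) ` edge_monomials E"
  show "edge_space E \<subseteq> {f :: ('v, 'k) mpoly. Poly_Mapping.keys f \<subseteq> edge_monomials E}"
    unfolding edge_space_def
  proof (rule mpoly.span_minimal)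
    show "mpoly.subspace {f :: ('v, 'k) mpoly. Poly_Mapping.keys f \<subseteq> edge_monomials E}"
    proof (rule mpoly.subspaceI)
      fix x y :: "('v, 'k) mpoly"
      assume "x \<in> {f. Poly_Mapping.keys f \<subseteq> edge_monomials E}"
        "y \<in> {f. Poly_Mapping.keys f \<subseteq> edge_monomials E}"
      then show "x + y \<in> {f. Poly_Mapping.keys f \<subseteq> edge_monomials E}"
        using Poly_Mapping.keys_add[of x y] by auto
    qed (auto simp: subset_iff in_keys_iff lookup_mpoly_scale)
  qed auto
  show "{f :: ('v, 'k) mpoly. Poly_Mapping.keys f \<subseteq> edge_monomials E} \<subseteq> edge_space E"
  proof clarify
    fix f :: "('v, 'k) mpoly" assume f: "Poly_Mapping.keys f \<subseteq> edge_monomials E"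
    have "f = (\<Sum>m\<in>Poly_Mapping.keys f. mpoly_scale (Poly_Mapping.lookup f m) (Poly_Mapping.single m 1))"
      by (rule poly_mapping_eqI)
        (auto simp: lookup_sum lookup_mpoly_scale lookup_single when_def in_keys_iff if_distrib
          cong: if_cong)
    also have "\<dots> \<in> edge_space E"
      unfolding edge_space_def using f
      by (intro mpoly.span_sum mpoly.span_scale mpoly.span_base) auto
    finally show "f \<in> edge_space E" .
  qed
qed

lemma num_terms_card_keys:
  fixes f :: "('v, 'k::field) mpoly"
  shows "f \<in> edge_space E \<Longrightarrow> num_terms E f = card (Poly_Mapping.keys f)"
  unfolding num_terms_def edge_space_keys
  by (intro arg_cong[where f = card]) (auto simp: in_keys_iff)

lemma mpoly_eval_edge_form:
  assumes "finite E" "\<And>e. e \<in> E \<Longrightarrow> card e = 2" "f \<in> edge_space E"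
  shows "mpoly_eval P f = (\<Sum>e\<in>E. Poly_Mapping.lookup f (edge_monomial e) * (\<Prod>v\<in>e. P v))"
proof -
  have fin: "finite e" if "e \<in> E" for e using assms(2)[OF that] by (intro card_ge_0_finite) simp
  have im: "edge_monomials E = edge_monomial ` E" using assms by (intro edge_monomials_image)
  have "mpoly_eval P f = (\<Sum>m\<in>edge_monomial ` E. Poly_Mapping.lookup f m *
        (\<Prod>v\<in>Poly_Mapping.keys m. P v ^ Poly_Mapping.lookup m v))"
    unfolding mpoly_eval_def using assms
    by (intro sum.mono_neutral_left) (auto simp: edge_space_keys im in_keys_iff)
  also have "\<dots> = (\<Sum>e\<in>E. Poly_Mapping.lookup f (edge_monomial e) *
        (\<Prod>v\<in>Poly_Mapping.keys (edge_monomial e). P v ^ Poly_Mapping.lookup (edge_monomial e) v))"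
    using fin by (subst sum.reindex) (auto intro: inj_on_edge_monomial)
  also have "\<dots> = (\<Sum>e\<in>E. Poly_Mapping.lookup f (edge_monomial e) * (\<Prod>v\<in>e. P v))"
    using fin by (intro sum.cong) (auto simp: keys_edge_monomial lookup_edge_monomial intro!: prod.cong)
  finally show ?thesis .
qed

lemma card_polys_with_keys:
  assumes "finite R"
  shows "card {f :: 'm \<Rightarrow>\<^sub>0 'k::{field, finite}. Poly_Mapping.keys f = R} = (CARD('k) - 1) ^ card R"
proof -
  let ?F = "\<lambda>y. Abs_poly_mapping (\<lambda>m. if m \<in> R then y m else 0) :: 'm \<Rightarrow>\<^sub>0 'k"
  have look: "Poly_Mapping.lookup (?F y) = (\<lambda>m. if m \<in> R then y m else 0)" for y
    by (rule lookup_Abs_poly_mapping) (rule finite_subset[OF _ assms], auto)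
  have "bij_betw (\<lambda>f. restrict (Poly_Mapping.lookup f) R)
      {f :: 'm \<Rightarrow>\<^sub>0 'k. Poly_Mapping.keys f = R} (torus R)"
  proof (rule bij_betw_byWitness[where f' = ?F])
    show "\<forall>f\<in>{f. Poly_Mapping.keys f = R}. ?F (restrict (Poly_Mapping.lookup f) R) = f"
      by (auto intro!: poly_mapping_eqI simp: look in_keys_iff)
    show "\<forall>y\<in>torus R. restrict (Poly_Mapping.lookup (?F y)) R = y"
      by (auto simp: look torus_def PiE_iff extensional_def fun_eq_iff)
    show "(\<lambda>f. restrict (Poly_Mapping.lookup f) R) ` {f. Poly_Mapping.keys f = R} \<subseteq> torus R"
      by (auto simp: torus_def in_keys_iff)
    show "?F ` torus R \<subseteq> {f. Poly_Mapping.keys f = R}"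
      by (auto simp: in_keys_iff look torus_def PiE_iff split: if_splits)
  qed
  then show ?thesis using bij_betw_same_card card_torus[OF assms] by metis
qed

lemma card_polys_with_num_terms:
  assumes "finite M"
  shows "card {f :: 'm \<Rightarrow>\<^sub>0 'k::{field, finite}. Poly_Mapping.keys f \<subseteq> M \<and> card (Poly_Mapping.keys f) = r}
    = (card M choose r) * (CARD('k) - 1) ^ r"
proof -
  let ?A = "{f :: 'm \<Rightarrow>\<^sub>0 'k. Poly_Mapping.keys f \<subseteq> M \<and> card (Poly_Mapping.keys f) = r}"
  let ?B = "{R. R \<subseteq> M \<and> card R = r}"
  have fin: "finite {f :: 'm \<Rightarrow>\<^sub>0 'k. Poly_Mapping.keys f = R}" if "R \<in> ?B" for R
  proof -
    have "finite R" using that assms finite_subset by blast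
    moreover have "0 < CARD('k) - 1"
      using card_mono[of UNIV "{0, 1 :: 'k}"] by simp
    ultimately have "0 < card {f :: 'm \<Rightarrow>\<^sub>0 'k. Poly_Mapping.keys f = R}"
      by (subst card_polys_with_keys) auto
    then show ?thesis by (rule card_ge_0_finite)
  qed
  have "?A = (\<Union>R\<in>?B. {f. Poly_Mapping.keys f = R})" by auto
  also have "card \<dots> = (\<Sum>R\<in>?B. card {f :: 'm \<Rightarrow>\<^sub>0 'k. Poly_Mapping.keys f = R})"
    using assms fin by (intro card_UN_disjoint) auto
  also have "\<dots> = (\<Sum>R\<in>?B. (CARD('k) - 1) ^ r)"
    using assms by (intro sum.cong refl) (auto simp: card_polys_with_keys finite_subset)
  also have "\<dots> = (card M choose r) * (CARD('k) - 1) ^ r"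
    using n_subsets[OF assms] by simp
  finally show ?thesis .
qed

lemma hamming_weight_codeword:
  assumes "distinct Ps" "set Ps = torus V"
  shows "hamming_weight (codeword Ps f) = card {P \<in> torus V. mpoly_eval P f \<noteq> 0}"
proof -
  have "{i. i < length (codeword Ps f) \<and> codeword Ps f ! i \<noteq> 0}
      = {i. i < length Ps \<and> mpoly_eval (Ps ! i) f \<noteq> 0}" by (auto simp: codeword_def)
  also have "card \<dots> = length (filter (\<lambda>P. mpoly_eval P f \<noteq> 0) Ps)"
    by (simp add: length_filter_conv_card)
  also have "\<dots> = card (set (filter (\<lambda>P. mpoly_eval P f \<noteq> 0) Ps))"
    using assms by (subst distinct_card) auto
  also have "set (filter (\<lambda>P. mpoly_eval P f \<noteq> 0) Ps) = {P \<in> torus V. mpoly_eval P f \<noteq> 0}"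
    using assms by auto
  finally show ?thesis by (simp add: hamming_weight_def)
qed

section \<open>The weight distribution\<close>

text \<open>What the counting uses about the shape of the graph: it has as many edges as vertices, it has at
least three of them, and non-zero edge values can be prescribed up to a common scalar.\<close>

lemma unique_induced_odd_cycle_structure:
  fixes E :: "'v set set"
  assumes G: "simple_graph V E" "connected_graph V E"
    and C: "unicyclic E" "induced_cycle E C" "odd (card C)"
  shows "finite E" "card E = card V" "3 \<le> card V"
    and "\<forall>e\<in>E. y e \<noteq> (0 :: 'k::field) \<Longrightarrow>
      \<exists>l P. l \<noteq> 0 \<and> (\<forall>v. P v \<noteq> 0) \<and> (\<forall>e\<in>E. l * (\<Prod>v\<in>e. P v) = y e)"
proof -
  have E: "e \<subseteq> V" "card e = 2" if "e \<in> E" for e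
    using G(1) that by (auto simp: simple_graph_def)
  have finV: "finite V" using G by (simp add: simple_graph_def)
  have cyc: "cycle_in E C" using C by (simp add: induced_cycle_def)
  have uniq: "D = C" if "induced_cycle E D" for D
    using C that by (auto simp: unicyclic_def)
  have growth: "pendant_growth C V E"
    using only_cycle_imp_pendant_growth[OF G cyc] cycle_eq_unique_induced_cycle[of E C] E uniq
    by metis
  obtain xs where xs: "distinct xs" "3 \<le> length xs" "C = cyclic_edges xs"
    using cyc by (auto simp: cycle_in_def)
  have UC: "\<Union> C = set xs" unfolding xs(3) using xs by (intro Union_cyclic_edges) auto
  have cardC: "card C = length xs" using card_cyclic_edges xs by blast
  have "finite C" using cardC xs(2) by (intro card_ge_0_finite) auto
  then have fin: "finite V \<and> finite E \<and> card E = card V"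
    using pendant_growth_card[OF growth] UC cardC distinct_card[OF xs(1)] by simp
  then show "finite E" "card E = card V" by auto
  have "card C \<le> card E" using pendant_growth_contains[OF growth] fin by (intro card_mono) auto
  then show "3 \<le> card V" using fin cardC xs by simp
  assume y: "\<forall>e\<in>E. y e \<noteq> 0"
  then have "\<forall>e\<in>C. y e \<noteq> 0" using pendant_growth_contains[OF growth] by auto
  then obtain l P where lP: "l \<noteq> 0" "\<forall>v. P v \<noteq> 0" "\<forall>e\<in>C. l * (\<Prod>v\<in>e. P v) = y e"
    using odd_cycle_scaled_solution[of xs y] xs C(3) cardC by auto
  show "\<exists>l P. l \<noteq> 0 \<and> (\<forall>v. P v \<noteq> 0) \<and> (\<forall>e\<in>E. l * (\<Prod>v\<in>e. P v) = y e)"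
    using pendant_growth_scaled_solution[OF growth lP(1) y lP(2,3)] lP(1) by blast
qed

lemma card_torus_nonzeros:
  fixes f :: "('v, 'k::{field, finite}) mpoly"
  assumes G: "simple_graph V E" "connected_graph V E"
    and C: "unicyclic E" "induced_cycle E C" "odd (card C)"
    and f: "f \<in> edge_space E"
  shows "int (card {P \<in> torus V. mpoly_eval P f \<noteq> 0})
    = edge_weight CARD('k) (card V) (num_terms E f)"
proof -
  note graph = unique_induced_odd_cycle_structure[OF G C]
  have E: "e \<subseteq> V" "card e = 2" if "e \<in> E" for e
    using G(1) that by (auto simp: simple_graph_def)
  have finV: "finite V" using G by (simp add: simple_graph_def)
  have fin: "finite e" if "e \<in> E" for e using E(1)[OF that] finV finite_subset by blast
  define c where "c e = Poly_Mapping.lookup f (edge_monomial e)" for e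
  have eval: "mpoly_eval P f = (\<Sum>e\<in>E. c e * (\<Prod>v\<in>e. P v))" for P
    unfolding c_def using mpoly_eval_edge_form[OF graph(1) E(2) f] .
  have im: "edge_monomials E = edge_monomial ` E" using edge_monomials_image E(2) by blast
  have "{m \<in> edge_monomials E. Poly_Mapping.lookup f m \<noteq> 0} = edge_monomial ` {e \<in> E. c e \<noteq> 0}"
    unfolding im c_def by auto
  then have terms: "num_terms E f = card {e \<in> E. c e \<noteq> 0}"
    unfolding num_terms_def using inj_on_edge_monomial[OF fin]
    by (metis (no_types, lifting) card_image inj_on_subset mem_Collect_eq subsetI)
  have "card {P \<in> torus V. mpoly_eval P f \<noteq> 0} = card {y \<in> torus E. (\<Sum>e\<in>E. c e * y e) \<noteq> 0}"
    unfolding eval by (rule card_edge_form_nonzeros[OF finV graph(1) E(1) graph(2,4)])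
  then show ?thesis
    using card_linear_form_nonzeros[OF graph(1), of c] by (simp add: graph(2) terms)
qed

theorem theorem5p1:
  fixes V :: "'v set" and E C :: "'v set set"
    and Ps :: "('v \<Rightarrow> 'k::{field, finite}) list"
    and q s :: nat
  assumes "CARD('k) = q" and "q > 2"
    and "simple_graph V E" and "card V = s"
    and "connected_graph V E"
    and "unicyclic E" and "induced_cycle E C" and "odd (card C)"
    and "distinct Ps" and "set Ps = torus V"
  shows
    "(\<forall>f \<in> (edge_space E :: ('v, 'k) mpoly set). \<forall>r. f \<noteq> 0 \<and> num_terms E f = r \<longrightarrow>
        int (card (torus_zeros V f)) = (\<Sum>i\<in>{1..<r}. (-1) ^ (i + 1) * (int q - 1) ^ (s - i)))
   \<and> (\<forall>r\<in>{1..s}. weight_count (edge_code Ps E) (nat (edge_weight q s r))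
                    = (s choose r) * (q - 1) ^ r)
   \<and> (\<forall>j\<ge>1. (\<forall>r\<in>{1..s}. int j \<noteq> edge_weight q s r) \<longrightarrow> weight_count (edge_code Ps E) j = 0)
   \<and> int (min_distance (edge_code Ps E)) = edge_weight q s 2
   \<and> min_distance (edge_code Ps E) = (q - 1) ^ (s - 1) * (q - 2)
   \<and> (\<forall>f \<in> edge_space E. num_terms E f = 2 \<longrightarrow>
        hamming_weight (codeword Ps f) = min_distance (edge_code Ps E))"
proof -
  note G = assms(3,5) and C = assms(6-8)
  note graph = unique_induced_odd_cycle_structure[OF G C]
  let ?F = "edge_space E :: ('v, 'k) mpoly set"
  let ?hw = "\<lambda>f. hamming_weight (codeword Ps f)"
  let ?M = "edge_monomials E"
  have E: "e \<subseteq> V" "card e = 2" if "e \<in> E" for e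
    using assms(3) that by (auto simp: simple_graph_def)
  have finV: "finite V" using assms(3) by (simp add: simple_graph_def)
  have fin: "finite e" if "e \<in> E" for e using E(1)[OF that] finV finite_subset by blast
  have s: "3 \<le> s" "card E = s" using graph assms(4) by auto
  have im: "?M = edge_monomial ` E" using edge_monomials_image E(2) by blast
  have M: "finite ?M" "card ?M = s"
    unfolding im using graph(1) s card_image[OF inj_on_edge_monomial[of E]] fin by auto
  have weight: "int (?hw f) = edge_weight q s (num_terms E f)" if "f \<in> ?F" for f
    unfolding hamming_weight_codeword[OF assms(9,10)]
    using card_torus_nonzeros[OF G C that] assms(1,4) by simp
  have terms_pos: "1 \<le> num_terms E f" if "f \<in> ?F" "f \<noteq> 0" for f
    using that num_terms_card_keys[OF that(1)] by (simp add: Suc_le_eq card_gt_0_iff)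
  have terms_le: "num_terms E f \<le> s" for f :: "('v, 'k) mpoly"
    unfolding num_terms_def M(2)[symmetric] using M by (intro card_mono) auto
  have zeros: "int (card (torus_zeros V f)) = (\<Sum>i\<in>{1..<r}. (-1) ^ (i + 1) * (int q - 1) ^ (s - i))"
    if f: "f \<in> ?F" "f \<noteq> 0" "num_terms E f = r" for f r
  proof -
    let ?N = "{P \<in> torus V. mpoly_eval P f \<noteq> 0}"
    have "card (torus_zeros V f) + card ?N = card (torus_zeros V f \<union> ?N)"
      using finite_torus[OF finV, where 'k = 'k]
      by (intro card_Un_disjoint[symmetric]) (auto simp: torus_zeros_def)
    also have "torus_zeros V f \<union> ?N = torus V" by (auto simp: torus_zeros_def)
    also have "card (torus V :: ('v \<Rightarrow> 'k) set) = (q - 1) ^ s"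
      using card_torus[OF finV, where 'k = 'k] assms(1,4) by simp
    finally have "card (torus_zeros V f) + card ?N = (q - 1) ^ s" .
    then have "int (card (torus_zeros V f)) + int (card ?N) = int ((q - 1) ^ s)"
      by (simp only: of_nat_add[symmetric])
    moreover have "int ((q - 1) ^ s) = (int q - 1) ^ s" using assms(2) by (simp add: of_nat_diff)
    moreover have "int (card ?N) = edge_weight q s r"
      using card_torus_nonzeros[OF G C f(1)] unfolding assms(1,4) f(3) .
    moreover have "1 \<le> r" using terms_pos[OF f(1,2)] unfolding f(3) .
    ultimately show ?thesis using edge_weight_split_first[of r q s] by linarith
  qed
  have eval: "mpoly_eval P f
      = (\<Sum>e\<in>E. Poly_Mapping.lookup f (edge_monomial e) * (\<Prod>v\<in>e. P v))"
    if "f \<in> ?F" for P and f :: "('v, 'k) mpoly"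
    using mpoly_eval_edge_form[OF graph(1) _ that] E(2) by blast
  \<comment> \<open>A non-zero difference would be a word of weight zero, but the weights \<open>W\<^sub>1, \<dots>, W\<^sub>s\<close> are positive.\<close>
  have inj: "inj_on (codeword Ps) ?F"
  proof (rule inj_onI, rule ccontr)
    fix f g assume fg: "f \<in> ?F" "g \<in> ?F" "codeword Ps f = codeword Ps g" "f \<noteq> g"
    have diff: "f - g \<in> ?F"
      using fg(1,2) unfolding edge_space_def by (rule mpoly.span_diff)
    have "mpoly_eval P (f - g) = 0" if "P \<in> set Ps" for P
    proof -
      have "mpoly_eval P f = mpoly_eval P g" using fg(3) that by (auto simp: codeword_def)
      then show ?thesis
        using eval[OF fg(1)] eval[OF fg(2)] eval[OF diff]
        by (simp add: lookup_minus left_diff_distrib sum_subtractf)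
    qed
    then have "?hw (f - g) = 0" by (auto simp: hamming_weight_def codeword_def)
    moreover have "0 < edge_weight q s (num_terms E (f - g))"
      using fg(4) terms_pos[OF diff] terms_le assms(2) by (intro edge_weight_pos) auto
    ultimately show False using weight[OF diff] by simp
  qed
  have count: "weight_count (edge_code Ps E) j = card {f \<in> ?F. ?hw f = j}" for j
  proof -
    have "{c \<in> edge_code Ps E. hamming_weight c = j} = codeword Ps ` {f \<in> ?F. ?hw f = j}"
      by (auto simp: edge_code_def)
    then show ?thesis
      unfolding weight_count_def using card_image[OF inj_on_subset[OF inj]]
      by (metis (no_types, lifting) mem_Collect_eq subsetI)
  qed
  have main: "weight_count (edge_code Ps E) (nat (edge_weight q s r)) = (s choose r) * (q - 1) ^ r"
    if r: "r \<in> {1..s}" for r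
  proof -
    have pos: "0 < edge_weight q s r" using r assms(2) by (intro edge_weight_pos) auto
    have "?hw f = nat (edge_weight q s r) \<longleftrightarrow> num_terms E f = r" if "f \<in> ?F" for f
    proof -
      have "?hw f = nat (edge_weight q s r) \<longleftrightarrow> int (?hw f) = edge_weight q s r"
        using pos by linarith
      also have "\<dots> \<longleftrightarrow> num_terms E f = r"
        unfolding weight[OF that] using edge_weight_inj[OF assms(2) terms_le[of f], of r] r by auto
      finally show ?thesis .
    qed
    then have "{f \<in> ?F. ?hw f = nat (edge_weight q s r)}
        = {f \<in> ?F. card (Poly_Mapping.keys f) = r}"
      using num_terms_card_keys by (metis (lifting))
    also have "\<dots> = {f. Poly_Mapping.keys f \<subseteq> ?M \<and> card (Poly_Mapping.keys f) = r}"
      unfolding edge_space_keys by blast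
    finally have polys: "{f \<in> ?F. ?hw f = nat (edge_weight q s r)}
        = {f. Poly_Mapping.keys f \<subseteq> ?M \<and> card (Poly_Mapping.keys f) = r}" .
    show ?thesis
      unfolding count polys
      using card_polys_with_num_terms[OF M(1), of r, where 'k = 'k] M(2) assms(1) by simp
  qed
  have only: "\<exists>r\<in>{1..s}. int j = edge_weight q s r"
    if j: "1 \<le> j" "weight_count (edge_code Ps E) j \<noteq> 0" for j
  proof -
    have "{f \<in> ?F. ?hw f = j} \<noteq> {}" using j(2) unfolding count by (metis card.empty)
    then obtain f where f: "f \<in> ?F" "?hw f = j" by blast
    have "num_terms E f \<noteq> 0"
    proof
      assume "num_terms E f = 0"
      then have "int (?hw f) = 0" using weight[OF f(1)] by (simp add: edge_weight_def)
      then show False using f j by simp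
    qed
    then show ?thesis using weight[OF f(1)] f terms_le[of f]
      by (intro bexI[of _ "num_terms E f"]) auto
  qed
  have pos2: "0 < edge_weight q s 2" using s assms(2) by (intro edge_weight_pos) auto
  have min: "int (min_distance (edge_code Ps E)) = edge_weight q s 2"
  proof -
    have "min_distance (edge_code Ps E) = nat (edge_weight q s 2)"
      unfolding min_distance_def
    proof (rule Least_equality)
      show "1 \<le> nat (edge_weight q s 2) \<and> weight_count (edge_code Ps E) (nat (edge_weight q s 2)) \<noteq> 0"
        using main[of 2] pos2 s assms(2) by simp
    next
      fix j assume j: "1 \<le> j \<and> weight_count (edge_code Ps E) j \<noteq> 0"
      then obtain r where "r \<in> {1..s}" "int j = edge_weight q s r" using only by blast
      then show "nat (edge_weight q s 2) \<le> j"
        using edge_weight_min[of q r s] s assms(2) by simp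
    qed
    then show ?thesis using pos2 by simp
  qed
  have two: "?hw f = min_distance (edge_code Ps E)" if "f \<in> ?F" "num_terms E f = 2" for f
    using weight[OF that(1)] min that(2) by simp
  have distance: "min_distance (edge_code Ps E) = (q - 1) ^ (s - 1) * (q - 2)"
    using min edge_weight_2[OF assms(2), of s] s(1) by (simp only: of_nat_eq_iff)
  show ?thesis
  proof (intro conjI)
    show "\<forall>f \<in> ?F. \<forall>r. f \<noteq> 0 \<and> num_terms E f = r \<longrightarrow>
        int (card (torus_zeros V f)) = (\<Sum>i\<in>{1..<r}. (-1) ^ (i + 1) * (int q - 1) ^ (s - i))"
      by (intro ballI allI impI, elim conjE) (rule zeros)
    show "\<forall>j\<ge>1. (\<forall>r\<in>{1..s}. int j \<noteq> edge_weight q s r) \<longrightarrow> weight_count (edge_code Ps E) j = 0"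
    proof (intro allI impI, rule ccontr)
      fix j :: nat
      assume "1 \<le> j" "\<forall>r\<in>{1..s}. int j \<noteq> edge_weight q s r" "weight_count (edge_code Ps E) j \<noteq> 0"
      then show False using only[of j] by blast
    qed
    show "\<forall>f \<in> edge_space E. num_terms E f = 2 \<longrightarrow> ?hw f = min_distance (edge_code Ps E)"
      by (intro ballI impI two)
  qed (rule min distance ballI main | assumption)+
qed

end
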